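(* Consider the online graph partitioning problem with $\ell$ servers and server capacity $k$, where the online algorithm may place up to $(1+\varepsilon)k$ vertices on each server, and suppose $\varepsilon>1$ is a fixed constant. Then there exists a deterministic online algorithm with competitive ratio $O(\log k)$.
   Context: Online graph partitioning problem: There is a vertex set $V$ with $|V|=\ell\cdot k$. Initially each vertex is assigned to one of $\ell$ servers so that every server holds exactly $k$ vertices, and the graph $G=(V,E)$ has $E=\emptyset$. Edges of $G$ are then revealed one by one in an online fashion. The request sequence is guaranteed to be such that at all times there exists an assignment of vertices to servers in which each server holds at most $k$ vertices and every connected component of the current graph lies entirely on one server. After each edge insertion, an online algorithm must (possibly) move vertices between servers so that every connected component of the revealed graph lies entirely on a single server (cc-condition), while each server holds at most $(1+\varepsilon)k$ vertices. Each vertex move costs $1/k$. The optimal offline algorithm $\mathrm{OPT}$ knows the whole sequence in advance and must keep at most $k$ vertices per server; its cost is the minimum total cost of moves needed. The (strict) competitive ratio of an online algorithm $\mathrm{ONL}$ is the supremum over request sequences of $\mathrm{cost}(\mathrm{ONL})/\mathrm{cost}(\mathrm{OPT})$; the edge insertion order is adversarial. *)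

theory Defs
  imports Complex_Main "HOL-Library.Landau_Symbols" "HOL-Library.Extended_Nonnegative_Real"
    "HOL-Library.FuncSet"
begin

text \<open>
  Edges are two-element vertex sets, the servers are \<open>0, \<dots>, l - 1\<close>, and an assignment
  is a function from vertices to servers, of which only the values on \<open>V\<close> matter.
\<close>

type_synonym 'v assignment = "'v \<Rightarrow> nat"

definition connected_components :: "'v set \<Rightarrow> 'v set set \<Rightarrow> 'v set set" where
  "connected_components V E =
     V // {(u, v). u \<in> V \<and> v \<in> V \<and> (u, v) \<in> {(x, y). {x, y} \<in> E}\<^sup>*}"

definition initial_assignment :: "nat \<Rightarrow> nat \<Rightarrow> 'v set \<Rightarrow> 'v assignment \<Rightarrow> bool" where
  "initial_assignment l k V a \<longleftrightarrow>
     a \<in> V \<rightarrow> {..<l} \<and> (\<forall>s<l. card {v \<in> V. a v = s} = k)"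

definition cc_condition :: "'v set \<Rightarrow> 'v set set \<Rightarrow> 'v assignment \<Rightarrow> bool" where
  "cc_condition V E a \<longleftrightarrow> (\<forall>C \<in> connected_components V E. \<exists>s. \<forall>v\<in>C. a v = s)"

definition feasible :: "nat \<Rightarrow> real \<Rightarrow> 'v set \<Rightarrow> 'v set set \<Rightarrow> 'v assignment \<Rightarrow> bool" where
  "feasible l c V E a \<longleftrightarrow>
     a \<in> V \<rightarrow> {..<l} \<and> (\<forall>s<l. real (card {v \<in> V. a v = s}) \<le> c) \<and> cc_condition V E a"

definition request_sequence :: "nat \<Rightarrow> nat \<Rightarrow> 'v set \<Rightarrow> 'v set list \<Rightarrow> bool" where
  "request_sequence l k V \<sigma> \<longleftrightarrow>
     (\<forall>e \<in> set \<sigma>. e \<subseteq> V \<and> card e = 2) \<and>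
     (\<forall>i \<le> length \<sigma>. \<exists>a. feasible l (real k) V (set (take i \<sigma>)) a)"

text \<open>
  A schedule for \<open>\<sigma>\<close> lists the assignments held after each of the requests;
  \<open>c\<close> is the capacity of a server.
\<close>

definition feasible_schedule ::
  "nat \<Rightarrow> real \<Rightarrow> 'v set \<Rightarrow> 'v set list \<Rightarrow> 'v assignment list \<Rightarrow> bool" where
  "feasible_schedule l c V \<sigma> as \<longleftrightarrow>
     length as = length \<sigma> \<and>
     (\<forall>i < length \<sigma>. feasible l c V (set (take (Suc i) \<sigma>)) (as ! i))"

definition moves :: "'v set \<Rightarrow> 'v assignment \<Rightarrow> 'v assignment \<Rightarrow> nat" where
  "moves V a b = card {v \<in> V. a v \<noteq> b v}"

definition schedule_cost :: "nat \<Rightarrow> 'v set \<Rightarrow> 'v assignment \<Rightarrow> 'v assignment list \<Rightarrow> real" where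
  "schedule_cost k V a\<^sub>0 as =
     (\<Sum>i<length as. real (moves V ((a\<^sub>0 # as) ! i) (as ! i)) / real k)"

definition opt_cost :: "nat \<Rightarrow> nat \<Rightarrow> 'v set \<Rightarrow> 'v assignment \<Rightarrow> 'v set list \<Rightarrow> real" where
  "opt_cost l k V a\<^sub>0 \<sigma> =
     Inf {schedule_cost k V a\<^sub>0 as | as. feasible_schedule l (real k) V \<sigma> as}"

text \<open>
  A deterministic online algorithm computes its current assignment from the initial
  assignment and the requests revealed so far.
\<close>

type_synonym 'v algorithm = "'v assignment \<Rightarrow> 'v set list \<Rightarrow> 'v assignment"

definition run :: "'v algorithm \<Rightarrow> 'v assignment \<Rightarrow> 'v set list \<Rightarrow> 'v assignment list" where
  "run A a\<^sub>0 \<sigma> = map (\<lambda>i. A a\<^sub>0 (take (Suc i) \<sigma>)) [0..<length \<sigma>]"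

definition online_algorithm :: "real \<Rightarrow> nat \<Rightarrow> nat \<Rightarrow> 'v set \<Rightarrow> 'v algorithm \<Rightarrow> bool" where
  "online_algorithm \<epsilon> l k V A \<longleftrightarrow>
     (\<forall>a\<^sub>0 \<sigma>. initial_assignment l k V a\<^sub>0 \<longrightarrow> request_sequence l k V \<sigma> \<longrightarrow>
        feasible_schedule l ((1 + \<epsilon>) * real k) V \<sigma> (run A a\<^sub>0 \<sigma>))"

text \<open>
  In \<^typ>\<open>ennreal\<close>, \<open>0 / 0 = 0\<close> and \<open>x / 0 = \<infinity>\<close> for \<open>x > 0\<close>: an algorithm with a finite ratio
  must not move at all when the optimum is zero.
\<close>

definition competitive_ratio :: "nat \<Rightarrow> nat \<Rightarrow> 'v set \<Rightarrow> 'v algorithm \<Rightarrow> ennreal" where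
  "competitive_ratio l k V A =
     (SUP (a\<^sub>0, \<sigma>) \<in> {(a\<^sub>0, \<sigma>). initial_assignment l k V a\<^sub>0 \<and> request_sequence l k V \<sigma>}.
        ennreal (schedule_cost k V a\<^sub>0 (run A a\<^sub>0 \<sigma>)) / ennreal (opt_cost l k V a\<^sub>0 \<sigma>))"

end

theory Submission
  imports Defs "HOL-Library.Disjoint_Sets"
begin

text \<open>
  Call a server the home of the vertices that it holds initially. When an edge joins components
  \<open>A\<close> and \<open>B\<close> with \<open>|B| \<le> |A|\<close>, the union \<open>U\<close> moves to the server that is home to at least
  three quarters of \<open>U\<close>, if there is one, and to the server of \<open>A\<close> otherwise. Then, while some
  server exceeds \<open>(1 + \<epsilon>) k\<close>, it holds a component at most half of which is at home there; such a
  component is evicted to a server of load at most \<open>k\<close>.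

  If \<open>v\<close> in a component \<open>C\<close> was moved \<open>m\<close> times by merges, then
  \<open>(3/2)^m \<le> |C| max(|C|, 2 h)\<close>, where \<open>h\<close> counts the vertices of \<open>C\<close> whose home is the current
  server: each such move multiplies one of the factors by \<open>3/2\<close>, and evictions do not decrease the
  product. So \<open>m = O(log k)\<close>. For each server \<open>s\<close>, at most four times as many vertices of \<open>C\<close> have
  been moved by merges as have their home outside \<open>s\<close>, so the number of these vertices is at most
  four times the number of moves of any offline solution. Evictions are paid for by the potential
  \<open>\<Sum>\<^sub>s max(0, load(s) - 2 k)\<close>, which a merge increases by at most the number of its moves and
  which an eviction decreases by at least \<open>min(1, \<epsilon> - 1)\<close> per moved vertex.
\<close>

section \<open>Connected components\<close>

lemma equiv_connected:
  "equiv V {(u, v). u \<in> V \<and> v \<in> V \<and> (u, v) \<in> {(x, y). {x, y} \<in> E}\<^sup>*}"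
proof (rule equivI)
  have "sym {(x, y). {x, y} \<in> E}"
    by (auto simp: sym_def insert_commute)
  then have "sym ({(x, y). {x, y} \<in> E}\<^sup>*)"
    by (rule sym_rtrancl)
  then show "sym {(u, v). u \<in> V \<and> v \<in> V \<and> (u, v) \<in> {(x, y). {x, y} \<in> E}\<^sup>*}"
    by (auto simp: sym_def)
qed (auto simp: refl_on_def trans_def)

lemma partition_on_connected_components: "partition_on V (connected_components V E)"
  unfolding connected_components_def by (rule partition_on_quotient) (rule equiv_connected)

lemma connected_components_empty: "connected_components V {} = (\<lambda>v. {v}) ` V"
  by (auto simp: connected_components_def quotient_def)

text \<open>The edge adds the two pairs \<open>(u, v)\<close> and \<open>(v, u)\<close> to the
  reachability relation, so the classes of \<open>u\<close> and \<open>v\<close> fuse and all others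
  stay. The case \<open>A = B\<close> is included; the set of components is then unchanged.\<close>

lemma connected_components_insert:
  assumes "A \<in> connected_components V E" "B \<in> connected_components V E" "u \<in> A" "v \<in> B"
  shows "connected_components V (insert {u, v} E) =
    insert (A \<union> B) (connected_components V E - {A, B})"
proof -
  define r where "r = {(x, y). {x, y} \<in> E}\<^sup>*"
  define r' where "r' = {(x, y). {x, y} \<in> insert {u, v} E}\<^sup>*"
  define K where "K = (\<lambda>x. {y \<in> V. (x, y) \<in> r})"
  define K' where "K' = (\<lambda>x. {y \<in> V. (x, y) \<in> r'})"
  have cc: "connected_components V E = K ` V"
    by (auto simp: connected_components_def quotient_def K_def r_def)
  have cc': "connected_components V (insert {u, v} E) = K' ` V"
    by (auto simp: connected_components_def quotient_def K'_def r'_def)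
  have "sym {(x, y). {x, y} \<in> E}"
    by (auto simp: sym_def insert_commute)
  then have symr: "(y, x) \<in> r" if "(x, y) \<in> r" for x y
    using that sym_rtrancl unfolding r_def sym_def by blast
  have transr: "(x, z) \<in> r" if "(x, y) \<in> r" "(y, z) \<in> r" for x y z
    using that unfolding r_def by auto
  have reflr: "(x, x) \<in> r" for x
    unfolding r_def by auto
  have uv: "u \<in> V" "v \<in> V" and A: "A = K u" and B: "B = K v"
    using assms unfolding cc K_def by (auto intro: symr transr)
  have edges: "{(x, y). {x, y} \<in> insert {u, v} E} = insert (u, v) (insert (v, u) {(x, y). {x, y} \<in> E})"
    by (auto simp: doubleton_eq_iff)
  have r': "(x, y) \<in> r' \<longleftrightarrow> (x, y) \<in> r \<or>
      ((x, u) \<in> r \<or> (x, v) \<in> r) \<and> ((u, y) \<in> r \<or> (v, y) \<in> r)" for x y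
  proof -
    \<comment> \<open>\<open>rtrancl_insert\<close> is applied twice, once for each orientation of
      the edge; symmetry of \<open>r\<close> then simplifies the result.\<close>
    have "r' = r \<union> {(x, y). (x, v) \<in> r \<and> (u, y) \<in> r} \<union>
        {(x, y). (x, u) \<in> r \<union> {(x, y). (x, v) \<in> r \<and> (u, y) \<in> r} \<and>
                 (v, y) \<in> r \<union> {(x, y). (x, v) \<in> r \<and> (u, y) \<in> r}}"
      using edges unfolding r'_def r_def by (simp only: rtrancl_insert)
    then show ?thesis
      by (auto intro: symr transr reflr)
  qed
  have K': "K' x = (if x \<in> A \<union> B then A \<union> B else K x)" if "x \<in> V" for x
    using that unfolding A B K_def K'_def by (auto simp: r' intro: symr transr)
  have same: "K x = A \<longleftrightarrow> x \<in> A" "K x = B \<longleftrightarrow> x \<in> B" if "x \<in> V" for x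
    using that unfolding A B K_def by (auto intro: symr transr reflr)
  show ?thesis
    unfolding cc cc'
  proof (intro equalityI subsetI)
    fix C assume "C \<in> K' ` V"
    then show "C \<in> insert (A \<union> B) (K ` V - {A, B})"
      using K' same by auto
  next
    fix C assume "C \<in> insert (A \<union> B) (K ` V - {A, B})"
    moreover have "A \<union> B \<in> K' ` V"
      using K'[OF uv(1)] uv assms(3) by (auto intro!: image_eqI[of _ _ u])
    moreover have "C \<in> K' ` V" if "x \<in> V" "C = K x" "C \<noteq> A" "C \<noteq> B" for x
      using that same[of x] K'[of x] by (auto intro!: image_eqI[of _ _ x])
    ultimately show "C \<in> K' ` V"
      by auto
  qed
qed

lemma sum_card_partition:
  assumes "finite V" "partition_on V P"
  shows "(\<Sum>C\<in>P. card {v \<in> C. Q v}) = card {v \<in> V. Q v}"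
proof -
  have "card (\<Union>C\<in>P. {v \<in> C. Q v}) = (\<Sum>C\<in>P. card {v \<in> C. Q v})"
  proof (rule card_UN_disjoint)
    show "finite P"
      using assms by (rule finite_elements)
    show "\<forall>C\<in>P. finite {v \<in> C. Q v}"
      using assms by (auto simp: partition_on_def intro: finite_subset[of _ V])
    show "\<forall>C\<in>P. \<forall>D\<in>P. C \<noteq> D \<longrightarrow> {v \<in> C. Q v} \<inter> {v \<in> D. Q v} = {}"
      using partition_onD2[OF assms(2)] by (auto simp: disjoint_def)
  qed
  moreover have "(\<Union>C\<in>P. {v \<in> C. Q v}) = {v \<in> V. Q v}"
    using partition_onD1[OF assms(2)] by auto
  ultimately show ?thesis by simp
qed

section \<open>Moves and loads\<close>

definition load :: "'v set \<Rightarrow> 'v assignment \<Rightarrow> nat \<Rightarrow> nat" where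
  "load V a s = card {v \<in> V. a v = s}"

text \<open>Subtraction on \<open>nat\<close> truncates at 0, so this is the eviction potential. For
  \<epsilon> > 1 and positive \<open>k\<close> its threshold \<open>2 * k\<close> lies below the
  online capacity, and the gap pays for evictions.\<close>

definition overload :: "nat \<Rightarrow> nat \<Rightarrow> 'v set \<Rightarrow> 'v assignment \<Rightarrow> nat" where
  "overload l k V a = (\<Sum>s<l. load V a s - 2 * k)"

lemma moves_triangle:
  assumes "finite V"
  shows "moves V a c \<le> moves V a b + moves V b c"
proof -
  have "card {v \<in> V. a v \<noteq> c v} \<le> card ({v \<in> V. a v \<noteq> b v} \<union> {v \<in> V. b v \<noteq> c v})"
    using assms by (intro card_mono) auto
  also have "\<dots> \<le> card {v \<in> V. a v \<noteq> b v} + card {v \<in> V. b v \<noteq> c v}"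
    by (rule card_Un_le)
  finally show ?thesis
    by (simp add: moves_def)
qed

text \<open>By the triangle inequality. The comparison with an offline schedule thus needs only its
  final assignment.\<close>

lemma moves_last_le_sum:
  assumes "finite V" "as \<noteq> []"
  shows "moves V a (last as) \<le> (\<Sum>i<length as. moves V ((a # as) ! i) (as ! i))"
  using assms(2)
proof (induction as arbitrary: a)
  case (Cons b bs)
  have split: "(\<Sum>i<length (b # bs). moves V ((a # b # bs) ! i) ((b # bs) ! i)) =
      moves V a b + (\<Sum>i<length bs. moves V ((b # bs) ! i) (bs ! i))"
    by (simp only: length_Cons sum.lessThan_Suc_shift nth_Cons_0 nth_Cons_Suc)
  show ?case
  proof (cases "bs = []")
    case False
    then show ?thesis
      using Cons.IH[OF False, of b] moves_triangle[OF assms(1), of a "last bs" b] split by simp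
  qed simp
qed simp

lemma sum_load:
  assumes "finite V" "a \<in> V \<rightarrow> {..<l}"
  shows "(\<Sum>s<l. load V a s) = card V"
proof -
  have "card V = (\<Sum>v\<in>V. 1)" by simp
  also have "\<dots> = (\<Sum>s<l. \<Sum>v\<in>{v \<in> V. a v = s}. 1)"
    using assms by (intro sum.group[symmetric]) auto
  finally show ?thesis
    by (simp add: load_def)
qed

text \<open>The load of a server grows by at most the number of moved vertices that arrive there,
  and each moved vertex arrives at exactly one server.\<close>

lemma overload_le_moves:
  assumes "finite V" "b \<in> V \<rightarrow> {..<l}"
  shows "overload l k V b \<le> overload l k V a + moves V a b"
proof -
  define M where "M = {v \<in> V. a v \<noteq> b v}"
  have "load V b s \<le> load V a s + load M b s" for s
  proof -
    have "load V b s \<le> card ({v \<in> V. a v = s} \<union> {v \<in> M. b v = s})"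
      unfolding load_def using assms(1) by (intro card_mono) (auto simp: M_def)
    also have "\<dots> \<le> load V a s + load M b s"
      unfolding load_def by (rule card_Un_le)
    finally show ?thesis .
  qed
  then have "load V b s - 2 * k \<le> (load V a s - 2 * k) + load M b s" for s
    by (smt (verit) add.commute diff_le_mono le_diff_conv nat_le_linear le_trans diff_is_0_eq
        le_add2 Nat.add_diff_assoc2)
  then have "overload l k V b \<le> (\<Sum>s<l. (load V a s - 2 * k) + load M b s)"
    unfolding overload_def by (rule sum_mono)
  also have "\<dots> = overload l k V a + card M"
  proof -
    have "finite M" "b \<in> M \<rightarrow> {..<l}"
      using assms by (auto simp: M_def)
    then show ?thesis
      by (simp add: sum.distrib overload_def sum_load)
  qed
  finally show ?thesis
    by (simp add: moves_def M_def)
qed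

section \<open>Merging and evicting\<close>

definition home :: "'v assignment \<Rightarrow> nat \<Rightarrow> 'v set \<Rightarrow> nat" where
  "home a\<^sub>0 s C = card {v \<in> C. a\<^sub>0 v = s}"

text \<open>The second factor in the bound on move counts. The 2 is chosen so that a component with
  at most half of its vertices at home has the least possible rank, namely its size, while three
  quarters at home give 3/2 of its size.\<close>

definition rank :: "'v assignment \<Rightarrow> 'v set \<Rightarrow> nat \<Rightarrow> nat" where
  "rank a\<^sub>0 C s = max (card C) (2 * home a\<^sub>0 s C)"

text \<open>The last clause protects a component mostly at home on one server: it is never evicted,
  and it stays put when merged into a union dominated by the same server.\<close>

definition located :: "nat \<Rightarrow> 'v set \<Rightarrow> 'v assignment \<Rightarrow> 'v set set \<Rightarrow> 'v assignment \<Rightarrow> bool" where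
  "located l V a\<^sub>0 P a \<longleftrightarrow> a \<in> V \<rightarrow> {..<l} \<and> (\<forall>C\<in>P. \<forall>u\<in>C. \<forall>v\<in>C. a u = a v) \<and>
     (\<forall>C\<in>P. \<forall>s. 3 * card C \<le> 4 * home a\<^sub>0 s C \<longrightarrow> (\<forall>v\<in>C. a v = s))"

text \<open>Here \<open>m v\<close> is the number of times that \<open>v\<close> was moved by merges.\<close>

definition counted :: "'v assignment \<Rightarrow> 'v set set \<Rightarrow> 'v assignment \<Rightarrow> ('v \<Rightarrow> nat) \<Rightarrow> bool" where
  "counted a\<^sub>0 P a m \<longleftrightarrow>
     (\<forall>C\<in>P. \<forall>v\<in>C. (3/2) ^ m v \<le> real (card C) * real (rank a\<^sub>0 C (a v))) \<and>
     (\<forall>C\<in>P. \<forall>s. card {v \<in> C. m v > 0} \<le> 4 * card {v \<in> C. a\<^sub>0 v \<noteq> s})"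

lemma located_range: "located l V a\<^sub>0 P a \<Longrightarrow> a \<in> V \<rightarrow> {..<l}"
  unfolding located_def by blast

lemma located_eq: "located l V a\<^sub>0 P a \<Longrightarrow> C \<in> P \<Longrightarrow> u \<in> C \<Longrightarrow> v \<in> C \<Longrightarrow> a u = a v"
  unfolding located_def by blast

lemma located_home:
  "located l V a\<^sub>0 P a \<Longrightarrow> C \<in> P \<Longrightarrow> 3 * card C \<le> 4 * home a\<^sub>0 s C \<Longrightarrow> v \<in> C \<Longrightarrow> a v = s"
  unfolding located_def by blast

lemma card_eq_home_plus:
  assumes "finite C"
  shows "card C = home a\<^sub>0 s C + card {v \<in> C. a\<^sub>0 v \<noteq> s}"
proof -
  have "C = {v \<in> C. a\<^sub>0 v = s} \<union> {v \<in> C. a\<^sub>0 v \<noteq> s}" by auto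
  then show ?thesis
    unfolding home_def using assms
    by (metis (no_types, lifting) card_Un_disjoint disjoint_iff finite_Un mem_Collect_eq)
qed

lemma home_le_card: "finite C \<Longrightarrow> home a\<^sub>0 s C \<le> card C"
  using card_eq_home_plus[of C a\<^sub>0 s] by simp

lemma home_Un_disjoint:
  assumes "finite A" "finite B" "A \<inter> B = {}"
  shows "home a\<^sub>0 s (A \<union> B) = home a\<^sub>0 s A + home a\<^sub>0 s B"
proof -
  have "{v \<in> A \<union> B. a\<^sub>0 v = s} = {v \<in> A. a\<^sub>0 v = s} \<union> {v \<in> B. a\<^sub>0 v = s}" by auto
  then show ?thesis
    unfolding home_def using assms by (auto intro!: card_Un_disjoint)
qed

lemma home_add_home_le:
  assumes "finite C" "s \<noteq> t"
  shows "home a\<^sub>0 s C + home a\<^sub>0 t C \<le> card C"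
proof -
  have "card {v \<in> C. a\<^sub>0 v = t} \<le> card {v \<in> C. a\<^sub>0 v \<noteq> s}"
    using assms by (intro card_mono) auto
  then show ?thesis
    using card_eq_home_plus[OF assms(1), of a\<^sub>0 s] by (simp add: home_def)
qed

text \<open>Each move is charged to growth by 3/2 of one factor in \<open>counted\<close>: the size
  for vertices of the smaller part \<open>B\<close>, the rank for those of the larger part
  \<open>A\<close>.\<close>

lemma merge_step:
  assumes fin: "finite V" and P: "partition_on V P" and a0: "a\<^sub>0 \<in> V \<rightarrow> {..<l}"
    and AB: "A \<in> P" "B \<in> P" "A \<noteq> B" and le: "card B \<le> card A"
    and loc: "located l V a\<^sub>0 P a" and cnt: "counted a\<^sub>0 P a m"
  defines "P' \<equiv> insert (A \<union> B) (P - {A, B})"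
  shows "\<exists>b. located l V a\<^sub>0 P' b \<and> counted a\<^sub>0 P' b (\<lambda>v. m v + of_bool (a v \<noteq> b v))"
proof -
  define U where "U = A \<union> B"
  have sub: "A \<subseteq> V" "B \<subseteq> V" and ne: "A \<noteq> {}" "B \<noteq> {}" and dj: "A \<inter> B = {}"
    using P AB by (auto simp: partition_on_def disjoint_def)
  have finAB: "finite A" "finite B" "finite U"
    using sub fin finite_subset unfolding U_def by auto
  have cU: "card U = card A + card B"
    unfolding U_def using finAB dj by (simp add: card_Un_disjoint)
  have hU: "home a\<^sub>0 s U = home a\<^sub>0 s A + home a\<^sub>0 s B" for s
    unfolding U_def using finAB dj by (simp add: home_Un_disjoint)
  obtain w where w: "w \<in> A" using ne by auto
  have cA: "card A > 0" using ne finAB by (simp add: card_gt_0_iff)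
  have aA: "a v = a w" if "v \<in> A" for v
    using located_eq[OF loc AB(1) that w] .
  \<comment> \<open>The target server: the home of at least three quarters of \<open>U\<close> if
    there is one, the server of \<open>A\<close> otherwise.\<close>
  obtain s where s: "3 * card U \<le> 4 * home a\<^sub>0 s U \<or>
      s = a w \<and> (\<forall>s. \<not> 3 * card U \<le> 4 * home a\<^sub>0 s U)"
    by blast
  have sl: "s < l"
  proof (cases "3 * card U \<le> 4 * home a\<^sub>0 s U")
    case True
    then have "home a\<^sub>0 s U \<noteq> 0"
      using cA cU by linarith
    then have "{v \<in> U. a\<^sub>0 v = s} \<noteq> {}"
      unfolding home_def by (metis card.empty)
    then show ?thesis
      using a0 sub unfolding U_def by auto
  next
    case False
    then show ?thesis
      using s located_range[OF loc] w sub by auto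
  qed
  \<comment> \<open>Two distinct such homes would together account for 3/2 of
    \<open>U\<close>.\<close>
  have uniq: "t = s" if "3 * card U \<le> 4 * home a\<^sub>0 t U" for t
  proof (rule ccontr)
    assume "t \<noteq> s"
    then have "home a\<^sub>0 s U + home a\<^sub>0 t U \<le> card U"
      by (intro home_add_home_le[OF finAB(3)]) simp
    moreover have "3 * card U \<le> 4 * home a\<^sub>0 s U"
      using s that by blast
    ultimately show False
      using that cA cU by linarith
  qed
  define b where "b = (\<lambda>v. if v \<in> U then s else a v)"
  define m' where "m' = (\<lambda>v. m v + of_bool (a v \<noteq> b v))"
  have old: "C \<in> P" "\<And>v. v \<in> C \<Longrightarrow> b v = a v" "\<And>v. v \<in> C \<Longrightarrow> m' v = m v"
    if C: "C \<in> P - {A, B}" for C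
  proof -
    have "C \<inter> U = {}"
      using P AB C by (auto simp: partition_on_def disjoint_def U_def)
    then show "\<And>v. v \<in> C \<Longrightarrow> b v = a v" "\<And>v. v \<in> C \<Longrightarrow> m' v = m v"
      by (auto simp: b_def m'_def)
  qed (use C in auto)
  have bU: "b v = s" if "v \<in> U" for v
    using that by (simp add: b_def)
  have "located l V a\<^sub>0 P' b"
    unfolding located_def
  proof (intro conjI ballI allI impI)
    show "b \<in> V \<rightarrow> {..<l}"
      using located_range[OF loc] sl by (auto simp: b_def)
  next
    fix C u v assume C: "C \<in> P'" "u \<in> C" "v \<in> C"
    show "b u = b v"
    proof (cases "C = U")
      case False
      then have "C \<in> P - {A, B}" using C by (auto simp: P'_def U_def)
      from old[OF this] show ?thesis
        using located_eq[OF loc _ C(2,3)] C by simp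
    qed (use C bU in simp)
  next
    fix C t v assume C: "C \<in> P'" "3 * card C \<le> 4 * home a\<^sub>0 t C" "v \<in> C"
    show "b v = t"
    proof (cases "C = U")
      case False
      then have "C \<in> P - {A, B}" using C by (auto simp: P'_def U_def)
      from old[OF this] show ?thesis
        using located_home[OF loc _ C(2,3)] C by simp
    qed (use C bU uniq in simp)
  qed
  moreover have "counted a\<^sub>0 P' b m'"
    unfolding counted_def
  proof (intro conjI ballI allI)
    fix C v assume C: "C \<in> P'" and v: "v \<in> C"
    show "(3/2) ^ m' v \<le> real (card C) * real (rank a\<^sub>0 C (b v))"
    proof (cases "C = U")
      case False
      then have "C \<in> P - {A, B}" using C by (auto simp: P'_def U_def)
      from old[OF this] show ?thesis
        using cnt v by (auto simp: counted_def)
    next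
      case True
      have bv: "b v = s" using True v bU by auto
      consider "v \<in> B" | "v \<in> A" "a w = s" | "v \<in> A" "a w \<noteq> s"
        using True v by (auto simp: U_def)
      then show ?thesis
      proof cases
        \<comment> \<open>Smaller part: \<open>U\<close> has at least twice the size of
          \<open>B\<close>, so the size factor pays for the move. The rank does not drop, being at
          most twice the size of \<open>B\<close> before and at least the size of \<open>U\<close>
          after.\<close>
        case 1
        have r: "rank a\<^sub>0 B (a v) \<le> rank a\<^sub>0 U s"
          using home_le_card[OF finAB(2), of a\<^sub>0 "a v"] cU le by (auto simp: rank_def)
        have "(3/2) ^ m' v \<le> (3/2::real) * (3/2) ^ m v"
          by (simp add: m'_def)
        also have "\<dots> \<le> 3/2 * (real (card B) * real (rank a\<^sub>0 B (a v)))"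
          using cnt AB 1 by (auto simp: counted_def)
        also have "\<dots> = (3/2 * real (card B)) * real (rank a\<^sub>0 B (a v))"
          by simp
        also have "\<dots> \<le> real (card U) * real (rank a\<^sub>0 U s)"
          using le cU r by (intro mult_mono) auto
        finally show ?thesis using True bv by simp
      next
        \<comment> \<open>The larger part stays where it is, and both factors can only grow.\<close>
        case 2
        have r: "rank a\<^sub>0 A (a v) \<le> rank a\<^sub>0 U s"
          using 2 aA[OF 2(1)] cU hU[of s] by (auto simp: rank_def)
        have "(3/2) ^ m' v = (3/2::real) ^ m v"
          using 2 aA[OF 2(1)] bv by (simp add: m'_def)
        also have "\<dots> \<le> real (card A) * real (rank a\<^sub>0 A (a v))"
          using cnt AB 2 by (auto simp: counted_def)
        also have "\<dots> \<le> real (card U) * real (rank a\<^sub>0 U s)"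
          using cU r by (intro mult_mono) auto
        finally show ?thesis using True bv by simp
      next
        \<comment> \<open>\<open>A\<close> leaves its server only for a dominant home, so the new
          rank is at least 3/2 of the size of \<open>U\<close>. At most a quarter of
          \<open>U\<close> has its home on the old server, so the old rank is at most the size of
          \<open>U\<close>.\<close>
        case 3
        have big: "3 * card U \<le> 4 * home a\<^sub>0 s U" using s 3 by auto
        have "home a\<^sub>0 (a v) A \<le> home a\<^sub>0 (a v) U" using hU by simp
        then have "rank a\<^sub>0 A (a v) \<le> card U"
          using big home_add_home_le[OF finAB(3), of s "a v" a\<^sub>0] 3 aA[OF 3(1)] cU
          by (auto simp: rank_def)
        then have r: "3/2 * real (rank a\<^sub>0 A (a v)) \<le> real (rank a\<^sub>0 U s)"
          using big by (auto simp: rank_def)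
        have "(3/2) ^ m' v \<le> (3/2::real) * (3/2) ^ m v"
          by (simp add: m'_def)
        also have "\<dots> \<le> 3/2 * (real (card A) * real (rank a\<^sub>0 A (a v)))"
          using cnt AB 3 by (auto simp: counted_def)
        also have "\<dots> = real (card A) * (3/2 * real (rank a\<^sub>0 A (a v)))"
          by simp
        also have "\<dots> \<le> real (card U) * real (rank a\<^sub>0 U s)"
          using cU r by (intro mult_mono) auto
        finally show ?thesis using True bv by simp
      qed
    qed
  next
    fix C t assume C: "C \<in> P'"
    show "card {v \<in> C. m' v > 0} \<le> 4 * card {v \<in> C. a\<^sub>0 v \<noteq> t}"
    proof (cases "C = U")
      case False
      then have "C \<in> P - {A, B}" using C by (auto simp: P'_def U_def)
      note o = old[OF this]
      have "{v \<in> C. m' v > 0} = {v \<in> C. m v > 0}" using o by auto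
      then show ?thesis using cnt o(1) by (auto simp: counted_def)
    next
      case True
      show ?thesis
      proof (cases "3 * card U \<le> 4 * home a\<^sub>0 t U")
        \<comment> \<open>More than a quarter of \<open>U\<close> has its home outside
          \<open>t\<close>, so all of \<open>U\<close> may be counted as moved.\<close>
        case False
        have "card {v \<in> U. m' v > 0} \<le> card U"
          using finAB by (intro card_mono) auto
        then show ?thesis
          using False True card_eq_home_plus[OF finAB(3), of a\<^sub>0 t] by simp
      next
        case big: True
        then have ts: "t = s" by (rule uniq)
        \<comment> \<open>If three quarters of \<open>D\<close> are at home on \<open>t\<close>,
          then \<open>D\<close> already sits there, does not move, and keeps its old bound;
          otherwise all of \<open>D\<close> may be counted.\<close>
        have part: "card {v \<in> D. m' v > 0} \<le> 4 * card {v \<in> D. a\<^sub>0 v \<noteq> t}"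
          if D: "D \<in> P" "D \<subseteq> U" for D
        proof (cases "3 * card D \<le> 4 * home a\<^sub>0 t D")
          case True
          then have "a v = b v" if "v \<in> D" for v
            using located_home[OF loc D(1) _ that] bU D that ts by auto
          then have "{v \<in> D. m' v > 0} = {v \<in> D. m v > 0}"
            by (auto simp: m'_def)
          then show ?thesis using cnt D by (auto simp: counted_def)
        next
          case False
          have fD: "finite D" using D finAB finite_subset by blast
          have "card {v \<in> D. m' v > 0} \<le> card D"
            using fD by (intro card_mono) auto
          then show ?thesis
            using False card_eq_home_plus[OF fD, of a\<^sub>0 t] by simp
        qed
        have "card {v \<in> U. m' v > 0} \<le> card {v \<in> A. m' v > 0} + card {v \<in> B. m' v > 0}"
          unfolding U_def by (rule order_trans[OF _ card_Un_le])
            (use finAB in \<open>auto intro!: card_mono\<close>)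
        also have "\<dots> \<le> 4 * card {v \<in> A. a\<^sub>0 v \<noteq> t} + 4 * card {v \<in> B. a\<^sub>0 v \<noteq> t}"
          using part[of A] part[of B] AB by (auto simp: U_def)
        also have "\<dots> = 4 * card {v \<in> U. a\<^sub>0 v \<noteq> t}"
          using card_eq_home_plus[OF finAB(1), of a\<^sub>0 t] card_eq_home_plus[OF finAB(2), of a\<^sub>0 t]
            card_eq_home_plus[OF finAB(3), of a\<^sub>0 t] cU hU[of t] by simp
        finally show ?thesis using True by simp
      qed
    qed
  qed
  ultimately show ?thesis
    unfolding m'_def by blast
qed

section \<open>Evictions\<close>

lemma ex_evictable:
  assumes fin: "finite V" and P: "partition_on V P" and loc: "located l V a\<^sub>0 P a"
    and home: "load V a\<^sub>0 t \<le> k" and over: "2 * k < load V a t"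
  shows "\<exists>C\<in>P. (\<forall>v\<in>C. a v = t) \<and> 2 * home a\<^sub>0 t C \<le> card C"
proof (rule ccontr)
  assume neg: "\<not> ?thesis"
  \<comment> \<open>Every component on \<open>t\<close> would have more than half of its vertices at
    home there, so the load of \<open>t\<close> would be at most twice its initial load.\<close>
  have "card {v \<in> C. a v = t} \<le> 2 * card {v \<in> C. a\<^sub>0 v = t}" if C: "C \<in> P" for C
  proof (cases "{v \<in> C. a v = t} = {}")
    case False
    then have at: "\<forall>v\<in>C. a v = t"
      using loc C unfolding located_def by blast
    then have "{v \<in> C. a v = t} = C" by auto
    then show ?thesis
      using neg C at by (force simp: home_def)
  qed (simp only: card.empty)
  then have "(\<Sum>C\<in>P. card {v \<in> C. a v = t}) \<le> (\<Sum>C\<in>P. 2 * card {v \<in> C. a\<^sub>0 v = t})"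
    by (rule sum_mono)
  then have "load V a t \<le> 2 * load V a\<^sub>0 t"
    using sum_card_partition[OF fin P] by (simp add: load_def flip: sum_distrib_left)
  then show False using home over by simp
qed

lemma ex_load_le_average:
  assumes "finite V" "a \<in> V \<rightarrow> {..<l}" "card V = l * k" "1 \<le> l"
  shows "\<exists>r<l. load V a r \<le> k"
proof (rule ccontr)
  assume "\<not> ?thesis"
  then have "(\<Sum>s<l. k) < (\<Sum>s<l. load V a s)"
    using assms(4) by (intro sum_strict_mono) (auto simp: not_le lessThan_empty_iff)
  then show False
    using sum_load[OF assms(1,2)] assms(3) by simp
qed

text \<open>The receiver ends with load at most \<open>2 * k\<close> and contributes no overload,
  while \<open>t\<close> sheds all of \<open>C\<close> or at least its whole excess over
  \<open>2 * k\<close>.\<close>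

lemma evict_step:
  assumes fin: "finite V" and C: "C \<subseteq> V" "card C \<le> k" and at: "\<forall>v\<in>C. a v = t" and t: "t < l"
    and r: "r < l" "load V a r \<le> k" and over: "(1 + \<epsilon>) * real k < real (load V a t)"
    and eps: "1 < \<epsilon>"
  defines "b \<equiv> (\<lambda>v. if v \<in> C then r else a v)"
  shows "min 1 (\<epsilon> - 1) * real (moves V a b) + real (overload l k V b) \<le> real (overload l k V a)"
proof -
  have "2 * real k \<le> (1 + \<epsilon>) * real k"
    using eps by (intro mult_right_mono) auto
  then have over2: "2 * k < load V a t" using over by linarith
  then have rt: "r \<noteq> t" using r by auto
  have fC: "finite C" using C fin finite_subset by blast
  have mv: "moves V a b = card C"
  proof -
    have "{v \<in> V. a v \<noteq> b v} = C" using C at rt by (auto simp: b_def)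
    then show ?thesis by (simp add: moves_def)
  qed
  have lt: "load V b t = load V a t - card C"
  proof -
    have "{v \<in> V. b v = t} = {v \<in> V. a v = t} - C" using rt by (auto simp: b_def)
    then show ?thesis
      unfolding load_def using C at fC by (auto intro!: card_Diff_subset)
  qed
  have lr: "load V b r \<le> 2 * k"
  proof -
    have "load V b r \<le> card ({v \<in> V. a v = r} \<union> C)"
      unfolding load_def using fin fC by (intro card_mono) (auto simp: b_def)
    also have "\<dots> \<le> load V a r + card C"
      unfolding load_def by (rule card_Un_le)
    finally show ?thesis using r C by simp
  qed
  have ls: "load V b s - 2 * k \<le> load V a s - 2 * k" if "s \<noteq> t" for s
  proof (cases "s = r")
    case False
    then have "{v \<in> V. b v = s} = {v \<in> V. a v = s}" using at that by (auto simp: b_def)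
    then show ?thesis by (simp add: load_def)
  qed (use lr in simp)
  have split: "overload l k V x = (load V x t - 2 * k) + (\<Sum>s\<in>{..<l} - {t}. load V x s - 2 * k)" for x
    unfolding overload_def using t by (subst sum.remove[of _ t]) auto
  have "(\<Sum>s\<in>{..<l} - {t}. load V b s - 2 * k) \<le> (\<Sum>s\<in>{..<l} - {t}. load V a s - 2 * k)"
    by (rule sum_mono) (use ls in auto)
  then have drop: "overload l k V b + min (card C) (load V a t - 2 * k) \<le> overload l k V a"
    using split[of a] split[of b] lt by linarith
  \<comment> \<open>The excess of \<open>t\<close> exceeds (\<epsilon> - 1) k, which is at least
    \<epsilon> - 1 per vertex of \<open>C\<close>. The 1 in the minimum covers the case that all of
    \<open>C\<close> counts as shed.\<close>
  have "(\<epsilon> - 1) * real (card C) \<le> (\<epsilon> - 1) * real k"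
    using eps C by (intro mult_left_mono) auto
  also have "\<dots> \<le> real (load V a t - 2 * k)"
    using over over2 by (simp add: of_nat_diff algebra_simps)
  finally have "min 1 (\<epsilon> - 1) * real (card C) \<le> real (min (card C) (load V a t - 2 * k))"
    by (auto simp: min_mult_distrib_right min_le_iff_disj of_nat_min simp del: of_nat_diff)
  moreover have "real (overload l k V b) + real (min (card C) (load V a t - 2 * k)) \<le>
      real (overload l k V a)"
    using drop by (simp only: of_nat_add[symmetric] of_nat_le_iff)
  ultimately show ?thesis
    using mv by simp
qed

text \<open>Evictions are iterated by induction on the overload, which drops strictly because a
  nonempty component changes its server. The counters \<open>m\<close> do not change.\<close>

lemma ex_eviction:
  assumes fin: "finite V" and cV: "card V = l * k" and l: "1 \<le> l" and k: "1 \<le> k"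
    and eps: "1 < \<epsilon>" and P: "partition_on V P" and small: "\<And>C. C \<in> P \<Longrightarrow> card C \<le> k"
    and init: "\<And>s. s < l \<Longrightarrow> load V a\<^sub>0 s \<le> k"
    and loc: "located l V a\<^sub>0 P a" and cnt: "counted a\<^sub>0 P a m"
  shows "\<exists>b. located l V a\<^sub>0 P b \<and> counted a\<^sub>0 P b m \<and>
    (\<forall>s<l. real (load V b s) \<le> (1 + \<epsilon>) * real k) \<and>
    min 1 (\<epsilon> - 1) * real (moves V a b) + real (overload l k V b) \<le> real (overload l k V a)"
  using loc cnt
proof (induction "overload l k V a" arbitrary: a rule: less_induct)
  case less
  note loc = less.prems(1) and cnt = less.prems(2)
  show ?case
  proof (cases "\<forall>s<l. real (load V a s) \<le> (1 + \<epsilon>) * real k")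
    case True
    then show ?thesis
      using loc cnt by (intro exI[of _ a]) (simp add: moves_def)
  next
    case False
    then obtain t where t: "t < l" and over: "(1 + \<epsilon>) * real k < real (load V a t)"
      by auto
    have "2 * real k \<le> (1 + \<epsilon>) * real k"
      using eps by (intro mult_right_mono) auto
    then have "2 * k < load V a t" using over by linarith
    then obtain C where C: "C \<in> P" and at: "\<forall>v\<in>C. a v = t" and half: "2 * home a\<^sub>0 t C \<le> card C"
      using ex_evictable[OF fin P loc init[OF t]] by blast
    have aV: "a \<in> V \<rightarrow> {..<l}" using loc by (rule located_range)
    obtain r where r: "r < l" "load V a r \<le> k"
      using ex_load_le_average[OF fin aV cV l] by blast
    have CV: "C \<subseteq> V" and Cne: "C \<noteq> {}" using P C by (auto simp: partition_on_def)
    have fC: "finite C" using CV fin finite_subset by blast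
    have C0: "card C > 0" using fC Cne by (simp add: card_gt_0_iff)
    define b where "b = (\<lambda>v. if v \<in> C then r else a v)"
    have other: "b v = a v" if "D \<in> P" "D \<noteq> C" "v \<in> D" for D v
      using P C that by (auto simp: b_def partition_on_def disjoint_def)
    have bC: "b v = r" if "v \<in> C" for v using that by (simp add: b_def)
    have step: "min 1 (\<epsilon> - 1) * real (moves V a b) + real (overload l k V b) \<le> real (overload l k V a)"
      unfolding b_def by (rule evict_step[OF fin CV small[OF C] at t r over eps])
    have "r \<noteq> t" using r \<open>2 * k < load V a t\<close> by auto
    have "C \<subseteq> {v \<in> V. a v \<noteq> b v}"
      using CV at bC \<open>r \<noteq> t\<close> by auto
    then have "0 < moves V a b"
      using Cne fin by (auto simp: moves_def card_gt_0_iff)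
    then have "0 < min 1 (\<epsilon> - 1) * real (moves V a b)"
      using eps by simp
    then have decr: "overload l k V b < overload l k V a"
      using step by linarith
    have locb: "located l V a\<^sub>0 P b"
      unfolding located_def
    proof (intro conjI ballI allI impI)
      show "b \<in> V \<rightarrow> {..<l}"
        using aV r by (auto simp: b_def)
    next
      fix D u v assume D: "D \<in> P" "u \<in> D" "v \<in> D"
      show "b u = b v"
        using located_eq[OF loc D] other[OF D(1)] D bC by (cases "D = C") simp_all
    next
      fix D s v assume D: "D \<in> P" "3 * card D \<le> 4 * home a\<^sub>0 s D" "v \<in> D"
      show "b v = s"
      proof (cases "D = C")
        case True
        \<comment> \<open>Three quarters at home on \<open>s\<close> would have placed
          \<open>C\<close> on \<open>s\<close>, which is then \<open>t\<close>; but at most half of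
          \<open>C\<close> is at home on \<open>t\<close>.\<close>
        then have "t = s" using located_home[OF loc D] D at by simp
        then show ?thesis using D True half C0 by simp
      qed (use located_home[OF loc D] D other[OF D(1)] in simp)
    qed
    have cntb: "counted a\<^sub>0 P b m"
      unfolding counted_def
    proof (intro conjI ballI)
      fix D v assume D: "D \<in> P" "v \<in> D"
      \<comment> \<open>The rank of \<open>C\<close> on \<open>t\<close> equals its size, the
        minimum over all servers, so no destination lowers it.\<close>
      have "rank a\<^sub>0 D (a v) \<le> rank a\<^sub>0 D (b v)"
        using other[of D v] D at half by (cases "D = C") (auto simp: rank_def)
      then have "real (card D) * real (rank a\<^sub>0 D (a v)) \<le> real (card D) * real (rank a\<^sub>0 D (b v))"
        by (intro mult_left_mono) auto
      then show "(3/2) ^ m v \<le> real (card D) * real (rank a\<^sub>0 D (b v))"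
        using cnt D by (force simp: counted_def)
    qed (use cnt in \<open>auto simp: counted_def\<close>)
    obtain c where c: "located l V a\<^sub>0 P c" "counted a\<^sub>0 P c m"
      "\<forall>s<l. real (load V c s) \<le> (1 + \<epsilon>) * real k"
      "min 1 (\<epsilon> - 1) * real (moves V b c) + real (overload l k V c) \<le> real (overload l k V b)"
      using less.hyps[OF decr locb cntb] by blast
    have "real (moves V a c) \<le> real (moves V a b) + real (moves V b c)"
      using moves_triangle[OF fin, of a c b] by linarith
    then have "min 1 (\<epsilon> - 1) * real (moves V a c) \<le>
        min 1 (\<epsilon> - 1) * (real (moves V a b) + real (moves V b c))"
      using eps by (intro mult_left_mono) auto
    then have "min 1 (\<epsilon> - 1) * real (moves V a c) + real (overload l k V c) \<le> real (overload l k V a)"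
      using step c(4) by (simp add: distrib_left)
    then show ?thesis using c by blast
  qed
qed

section \<open>The online algorithm\<close>

text \<open>The counters serve the analysis. They are part of the state because the choice of the
  next state refers to them; the algorithm outputs only the assignment.\<close>

definition invariant ::
  "real \<Rightarrow> nat \<Rightarrow> nat \<Rightarrow> 'v set \<Rightarrow> 'v assignment \<Rightarrow> 'v set set \<Rightarrow> 'v assignment \<times> ('v \<Rightarrow> nat) \<Rightarrow> bool"
where
  "invariant \<epsilon> l k V a\<^sub>0 E = (\<lambda>(a, m).
     located l V a\<^sub>0 (connected_components V E) a \<and> counted a\<^sub>0 (connected_components V E) a m \<and>
     (\<forall>s<l. real (load V a s) \<le> (1 + \<epsilon>) * real k))"

text \<open>Amortised cost of a step with respect to the potential
  \<open>overload l k V a - (1 + \<delta>) * sum m V\<close>.\<close>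

definition step_cost ::
  "real \<Rightarrow> nat \<Rightarrow> nat \<Rightarrow> 'v set \<Rightarrow> 'v assignment \<times> ('v \<Rightarrow> nat) \<Rightarrow> 'v assignment \<times> ('v \<Rightarrow> nat) \<Rightarrow> bool"
where
  "step_cost \<delta> l k V = (\<lambda>(a, m) (b, m').
     \<delta> * real (moves V a b) + real (overload l k V b) + (1 + \<delta>) * real (sum m V) \<le>
     real (overload l k V a) + (1 + \<delta>) * real (sum m' V))"

text \<open>The requests are listed latest first.\<close>

fun state ::
  "real \<Rightarrow> nat \<Rightarrow> nat \<Rightarrow> 'v set \<Rightarrow> 'v assignment \<Rightarrow> 'v set list \<Rightarrow> 'v assignment \<times> ('v \<Rightarrow> nat)"
where
  "state \<epsilon> l k V a\<^sub>0 [] = (a\<^sub>0, \<lambda>_. 0)"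
| "state \<epsilon> l k V a\<^sub>0 (e # es) =
     (SOME y. invariant \<epsilon> l k V a\<^sub>0 (set (e # es)) y \<and>
        step_cost (min 1 (\<epsilon> - 1)) l k V (state \<epsilon> l k V a\<^sub>0 es) y)"

text \<open>A merge is followed by evictions. Each merge move costs \<delta> as a move and at most 1
  in overload, which is the 1 + \<delta> credited for raising its counter; evictions are paid for by
  the overload.\<close>

lemma ex_step:
  assumes fin: "finite V" and cV: "card V = l * k" and l: "1 \<le> l" and k: "1 \<le> k"
    and eps: "1 < \<epsilon>" and init: "initial_assignment l k V a\<^sub>0"
    and e: "e \<subseteq> V" "card e = 2"
    and small: "\<And>C. C \<in> connected_components V (insert e E) \<Longrightarrow> card C \<le> k"
    and inv: "invariant \<epsilon> l k V a\<^sub>0 E x"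
  shows "\<exists>y. invariant \<epsilon> l k V a\<^sub>0 (insert e E) y \<and> step_cost (min 1 (\<epsilon> - 1)) l k V x y"
proof -
  define P where "P = connected_components V E"
  define \<delta> where "\<delta> = min 1 (\<epsilon> - 1)"
  obtain a m where x: "x = (a, m)" by force
  have P: "partition_on V P"
    unfolding P_def by (rule partition_on_connected_components)
  have loc: "located l V a\<^sub>0 P a" and cnt: "counted a\<^sub>0 P a m"
    and load: "\<forall>s<l. real (load V a s) \<le> (1 + \<epsilon>) * real k"
    using inv by (auto simp: invariant_def x P_def)
  obtain u v where uv: "e = {u, v}" "u \<noteq> v"
    using e(2) by (auto simp: card_2_iff)
  have "u \<in> \<Union>P" "v \<in> \<Union>P"
    using partition_onD1[OF P] e(1) uv by auto
  then obtain A B where A: "A \<in> P" "u \<in> A" and B: "B \<in> P" "v \<in> B" by auto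
  have ins: "connected_components V (insert e E) = insert (A \<union> B) (P - {A, B})"
    using connected_components_insert[of A V E B u v] A B uv by (simp add: P_def)
  show ?thesis
  proof (cases "A = B")
    \<comment> \<open>An edge inside a component changes nothing, so the old state serves as the new
      one.\<close>
    case True
    then have "connected_components V (insert e E) = P"
      using ins A by auto
    then show ?thesis
      using loc cnt load
      by (intro exI[of _ x]) (simp add: invariant_def step_cost_def x moves_def)
  next
    case False
    have a0: "a\<^sub>0 \<in> V \<rightarrow> {..<l}" and load0: "\<And>s. s < l \<Longrightarrow> Submission.load V a\<^sub>0 s \<le> k"
      using init by (auto simp: initial_assignment_def load_def)
    let ?P = "insert (A \<union> B) (P - {A, B})"
    obtain b where b: "located l V a\<^sub>0 ?P b" "counted a\<^sub>0 ?P b (\<lambda>v. m v + of_bool (a v \<noteq> b v))"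
    proof (cases "card B \<le> card A")
      case True
      then show ?thesis
        using merge_step[OF fin P a0 A(1) B(1) False True loc cnt] that by blast
    next
      case le: False
      \<comment> \<open>The roles are exchanged, since \<open>merge_step\<close> takes the larger
        part first.\<close>
      have "insert (B \<union> A) (P - {B, A}) = ?P" by auto
      then show ?thesis
        using merge_step[OF fin P a0 B(1) A(1) False[symmetric] _ loc cnt] le that by auto
    qed
    define m' where "m' = (\<lambda>v. m v + of_bool (a v \<noteq> b v))"
    have P': "partition_on V ?P"
      using partition_on_connected_components[of V "insert e E"] ins by simp
    obtain c where c: "located l V a\<^sub>0 ?P c" "counted a\<^sub>0 ?P c m'"
      "\<forall>s<l. real (Submission.load V c s) \<le> (1 + \<epsilon>) * real k"
      "\<delta> * real (moves V b c) + real (overload l k V c) \<le> real (overload l k V b)"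
      using ex_eviction[OF fin cV l k eps P' small[unfolded ins] load0 b]
      unfolding m'_def \<delta>_def by blast
    have "sum m' V = sum m V + moves V a b"
      using fin by (simp add: m'_def sum.distrib moves_def Int_def)
    then have "(1 + \<delta>) * real (sum m' V) =
        (1 + \<delta>) * real (sum m V) + real (moves V a b) + \<delta> * real (moves V a b)"
      by (simp only: of_nat_add) (simp add: algebra_simps)
    moreover have "real (overload l k V b) \<le> real (overload l k V a) + real (moves V a b)"
      using overload_le_moves[OF fin, of b l k a] b by (simp add: located_def flip: of_nat_add)
    moreover have "\<delta> * real (moves V a c) \<le> \<delta> * (real (moves V a b) + real (moves V b c))"
      using moves_triangle[OF fin, of a c b] eps
      by (intro mult_left_mono) (auto simp: \<delta>_def simp flip: of_nat_add)
    ultimately have "step_cost \<delta> l k V x (c, m')"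
      using c(4) unfolding step_cost_def x prod.case distrib_left[of \<delta>] by linarith
    then show ?thesis
      using c ins by (intro exI[of _ "(c, m')"]) (simp add: invariant_def \<delta>_def)
  qed
qed

section \<open>Comparison with offline assignments\<close>

lemma feasible_card_component_le:
  assumes "finite V" "feasible l (real k) V E a" "C \<in> connected_components V E"
  shows "card C \<le> k"
proof -
  have C: "C \<subseteq> V" "C \<noteq> {}"
    using assms(3) partition_on_connected_components[of V E] by (auto simp: partition_on_def)
  obtain s where s: "\<forall>v\<in>C. a v = s"
    using assms(2,3) unfolding feasible_def cc_condition_def by blast
  then have "s < l" using C assms(2) by (auto simp: feasible_def)
  have "card C \<le> card {v \<in> V. a v = s}"
    using assms(1) C s by (intro card_mono) auto
  then show ?thesis
    using assms(2) \<open>s < l\<close> by (force simp: feasible_def)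
qed

lemma sum_counted_le_moves:
  assumes fin: "finite V" and k: "1 \<le> k"
    and small: "\<And>C. C \<in> connected_components V E \<Longrightarrow> card C \<le> k"
    and cnt: "counted a\<^sub>0 (connected_components V E) a m" and cc: "cc_condition V E c"
  shows "real (sum m V) \<le> 4 * (ln (2 * real k ^ 2) / ln (3/2)) * real (moves V a\<^sub>0 c)"
proof -
  define P where "P = connected_components V E"
  \<comment> \<open>The logarithm of \<open>2 * k^2\<close> to base 3/2: sizes are at most
    \<open>k\<close> and ranks at most \<open>2 * k\<close>.\<close>
  define L where "L = ln (2 * real k ^ 2) / ln (3/2 :: real)"
  have P: "partition_on V P"
    unfolding P_def by (rule partition_on_connected_components)
  have k2: "1 \<le> real k ^ 2" using k by simp
  have L0: "0 \<le> L"
    unfolding L_def using k2 by (intro divide_nonneg_nonneg ln_ge_zero) linarith+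
  have mL: "real (m v) \<le> L" if v: "v \<in> V" for v
  proof -
    obtain C where C: "C \<in> P" "v \<in> C" using partition_onD1[OF P] v by auto
    have fC: "finite C" using C P fin by (auto simp: partition_on_def intro: finite_subset[of _ V])
    have cC: "card C \<le> k" using small C by (simp add: P_def)
    have "(3/2) ^ m v \<le> real (card C) * real (rank a\<^sub>0 C (a v))"
      using cnt C by (auto simp: counted_def P_def)
    also have "\<dots> \<le> real k * (2 * real k)"
      using cC home_le_card[OF fC, of a\<^sub>0 "a v"] by (intro mult_mono) (auto simp: rank_def)
    finally have "(3/2) ^ m v \<le> 2 * real k ^ 2"
      by (simp add: power2_eq_square)
    then have "ln ((3/2) ^ m v) \<le> ln (2 * real k ^ 2)"
      by (intro ln_mono) (use k in auto)
    then have "real (m v) * ln (3/2) \<le> ln (2 * real k ^ 2)"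
      by (simp add: ln_realpow)
    then show ?thesis
      by (simp add: L_def pos_le_divide_eq)
  qed
  have "real (sum m V) = (\<Sum>v\<in>V. real (m v))" by simp
  also have "\<dots> = (\<Sum>v\<in>{v \<in> V. m v > 0}. real (m v))"
    using fin by (intro sum.mono_neutral_right) auto
  also have "\<dots> \<le> (\<Sum>v\<in>{v \<in> V. m v > 0}. L)"
    using mL by (intro sum_mono) auto
  also have "\<dots> = L * real (card {v \<in> V. m v > 0})" by simp
  also have "\<dots> \<le> L * real (4 * moves V a\<^sub>0 c)"
  proof (intro mult_left_mono L0 of_nat_mono)
    have "card {v \<in> V. m v > 0} = (\<Sum>C\<in>P. card {v \<in> C. m v > 0})"
      using sum_card_partition[OF fin P] by simp
    also have "\<dots> \<le> (\<Sum>C\<in>P. 4 * card {v \<in> C. a\<^sub>0 v \<noteq> c v})"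
    proof (rule sum_mono)
      fix C assume C: "C \<in> P"
      \<comment> \<open>The second clause of \<open>counted\<close> holds for every server, hence
        for the one on which \<open>c\<close> puts \<open>C\<close>; the vertices with another home
        are those that \<open>c\<close> has to move.\<close>
      obtain s where s: "\<forall>v\<in>C. c v = s"
        using cc C by (auto simp: cc_condition_def P_def)
      then have "{v \<in> C. a\<^sub>0 v \<noteq> c v} = {v \<in> C. a\<^sub>0 v \<noteq> s}" by auto
      then show "card {v \<in> C. m v > 0} \<le> 4 * card {v \<in> C. a\<^sub>0 v \<noteq> c v}"
        using cnt C by (simp add: counted_def P_def)
    qed
    also have "\<dots> = 4 * moves V a\<^sub>0 c"
      using sum_card_partition[OF fin P] by (simp add: moves_def flip: sum_distrib_left)
    finally show "card {v \<in> V. m v > 0} \<le> 4 * moves V a\<^sub>0 c" .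
  qed
  finally show ?thesis by (simp add: L_def mult_ac)
qed

text \<open>All components are singletons, each placed at its home, so the home clause of
  \<open>located\<close> holds and size times rank is at least 1.\<close>

lemma invariant_initial:
  assumes "1 < \<epsilon>" "initial_assignment l k V a\<^sub>0"
  shows "invariant \<epsilon> l k V a\<^sub>0 {} (a\<^sub>0, \<lambda>_. 0)"
proof -
  have "home a\<^sub>0 s {v} = of_bool (a\<^sub>0 v = s)" for s v
    by (auto simp: home_def Collect_conv_if)
  moreover have "real k \<le> (1 + \<epsilon>) * real k"
    using assms(1) by (simp add: algebra_simps)
  ultimately show ?thesis
    using assms(2)
    by (auto simp: invariant_def located_def counted_def connected_components_empty load_def
        initial_assignment_def rank_def)
qed

section \<open>Cost of a whole run\<close>

context
  fixes \<epsilon> :: real and l k :: nat and V :: "'v set" and a\<^sub>0 :: "'v assignment" and \<sigma> :: "'v set list"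
  assumes fin: "finite V" and cV: "card V = l * k" and l: "1 \<le> l" and k: "1 \<le> k"
    and eps: "1 < \<epsilon>" and init: "initial_assignment l k V a\<^sub>0" and req: "request_sequence l k V \<sigma>"
begin

private abbreviation "st i \<equiv> state \<epsilon> l k V a\<^sub>0 (rev (take i \<sigma>))"

lemma card_component_le:
  "i \<le> length \<sigma> \<Longrightarrow> C \<in> connected_components V (set (take i \<sigma>)) \<Longrightarrow> card C \<le> k"
  using req feasible_card_component_le[OF fin] unfolding request_sequence_def by blast

text \<open>The choice made by \<open>SOME\<close> is justified by \<open>ex_step\<close>, which
  requires the invariant of the previous state.\<close>

lemma state_Suc:
  assumes i: "i < length \<sigma>" and inv: "invariant \<epsilon> l k V a\<^sub>0 (set (take i \<sigma>)) (st i)"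
  shows "invariant \<epsilon> l k V a\<^sub>0 (set (take (Suc i) \<sigma>)) (st (Suc i)) \<and>
    step_cost (min 1 (\<epsilon> - 1)) l k V (st i) (st (Suc i))"
proof -
  have e: "\<sigma> ! i \<subseteq> V" "card (\<sigma> ! i) = 2"
    using req i by (auto simp: request_sequence_def)
  have S: "set (take (Suc i) \<sigma>) = insert (\<sigma> ! i) (set (take i \<sigma>))"
    using i by (simp add: take_Suc_conv_app_nth)
  have "\<exists>y. invariant \<epsilon> l k V a\<^sub>0 (insert (\<sigma> ! i) (set (take i \<sigma>))) y \<and>
      step_cost (min 1 (\<epsilon> - 1)) l k V (st i) y"
    using card_component_le[of "Suc i"] i unfolding S
    by (intro ex_step[OF fin cV l k eps init e _ inv]) auto
  then have "\<exists>y. invariant \<epsilon> l k V a\<^sub>0 (set (take (Suc i) \<sigma>)) y \<and>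
      step_cost (min 1 (\<epsilon> - 1)) l k V (st i) y"
    unfolding S .
  from someI_ex[OF this] show ?thesis
    using i by (simp add: take_Suc_conv_app_nth)
qed

lemma invariant_state: "i \<le> length \<sigma> \<Longrightarrow> invariant \<epsilon> l k V a\<^sub>0 (set (take i \<sigma>)) (st i)"
proof (induction i)
  case 0
  then show ?case using invariant_initial[OF eps init] by simp
next
  case (Suc i)
  then show ?case using state_Suc[of i] by simp
qed

text \<open>The amortised step costs telescope. Initially every load is \<open>k\<close> and all
  counters are 0, so the potential starts at 0.\<close>

lemma sum_moves_state:
  "n \<le> length \<sigma> \<Longrightarrow>
   min 1 (\<epsilon> - 1) * (\<Sum>i<n. real (moves V (fst (st i)) (fst (st (Suc i))))) +
   real (overload l k V (fst (st n))) \<le> (1 + min 1 (\<epsilon> - 1)) * real (sum (snd (st n)) V)"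
proof (induction n)
  case 0
  then show ?case using init by (simp add: overload_def load_def initial_assignment_def)
next
  case (Suc n)
  define \<delta> where "\<delta> = min 1 (\<epsilon> - 1)"
  have n: "n < length \<sigma>" "n \<le> length \<sigma>"
    using Suc.prems by simp_all
  have "step_cost \<delta> l k V (st n) (st (Suc n))"
    unfolding \<delta>_def using state_Suc[OF n(1) invariant_state[OF n(2)]] by (rule conjunct2)
  then show ?case
    using Suc.IH[OF n(2)]
    unfolding step_cost_def case_prod_unfold sum.lessThan_Suc \<delta>_def[symmetric]
      distrib_left[of \<delta>]
    by linarith
qed

lemma feasible_state:
  assumes "i \<le> length \<sigma>"
  shows "feasible l ((1 + \<epsilon>) * real k) V (set (take i \<sigma>)) (fst (st i))"
proof -
  let ?P = "connected_components V (set (take i \<sigma>))"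
  have loc: "located l V a\<^sub>0 ?P (fst (st i))"
    and "\<forall>s<l. real (load V (fst (st i)) s) \<le> (1 + \<epsilon>) * real k"
    using invariant_state[OF assms] by (simp_all add: invariant_def case_prod_unfold)
  moreover have "\<exists>s. \<forall>v\<in>C. fst (st i) v = s" if "C \<in> ?P" for C
    using located_eq[OF loc that] by blast
  ultimately show ?thesis
    using located_range[OF loc] unfolding feasible_def load_def cc_condition_def by blast
qed

lemma feasible_schedule_run:
  "feasible_schedule l ((1 + \<epsilon>) * real k) V \<sigma> (run (\<lambda>a \<sigma>. fst (state \<epsilon> l k V a (rev \<sigma>))) a\<^sub>0 \<sigma>)"
  unfolding feasible_schedule_def
proof (intro conjI allI impI)
  fix i assume i: "i < length \<sigma>"
  then have "run (\<lambda>a \<sigma>. fst (state \<epsilon> l k V a (rev \<sigma>))) a\<^sub>0 \<sigma> ! i = fst (st (Suc i))"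
    by (simp add: run_def)
  then show "feasible l ((1 + \<epsilon>) * real k) V (set (take (Suc i) \<sigma>))
      (run (\<lambda>a \<sigma>. fst (state \<epsilon> l k V a (rev \<sigma>))) a\<^sub>0 \<sigma> ! i)"
    using feasible_state[of "Suc i"] i by simp
qed (simp add: run_def)

lemma schedule_cost_run:
  "schedule_cost k V a\<^sub>0 (run (\<lambda>a \<sigma>. fst (state \<epsilon> l k V a (rev \<sigma>))) a\<^sub>0 \<sigma>) =
   (\<Sum>i<length \<sigma>. real (moves V (fst (st i)) (fst (st (Suc i))))) / real k"
proof -
  \<comment> \<open>Prepending the initial assignment shifts the indices: entry \<open>i\<close> is
    the assignment after \<open>i\<close> requests.\<close>
  have "(a\<^sub>0 # run (\<lambda>a \<sigma>. fst (state \<epsilon> l k V a (rev \<sigma>))) a\<^sub>0 \<sigma>) ! i = fst (st i)"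
    if "i < length \<sigma>" for i
    using that by (cases i) (simp_all add: run_def)
  then show ?thesis
    unfolding schedule_cost_def sum_divide_distrib
    by (intro sum.cong) (auto simp: run_def)
qed

text \<open>The moves of the run are bounded by the final counters, these by the distance to the
  last offline assignment, and that by the moves of the schedule.\<close>

lemma run_cost_le_schedule_cost:
  assumes as: "feasible_schedule l (real k) V \<sigma> as"
  shows "schedule_cost k V a\<^sub>0 (run (\<lambda>a \<sigma>. fst (state \<epsilon> l k V a (rev \<sigma>))) a\<^sub>0 \<sigma>) \<le>
    (1 + min 1 (\<epsilon> - 1)) / min 1 (\<epsilon> - 1) * (4 * (ln (2 * real k ^ 2) / ln (3/2))) *
    schedule_cost k V a\<^sub>0 as"
proof (cases "\<sigma> = []")
  case True
  then show ?thesis using as by (simp add: run_def schedule_cost_def feasible_schedule_def)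
next
  case False
  define n where "n = length \<sigma>"
  define \<delta> where "\<delta> = min 1 (\<epsilon> - 1)"
  define L where "L = 4 * (ln (2 * real k ^ 2) / ln (3/2 :: real))"
  define M where "M = (\<Sum>i<length as. moves V ((a\<^sub>0 # as) ! i) (as ! i))"
  have \<delta>: "0 < \<delta>" using eps by (simp add: \<delta>_def)
  have "1 \<le> real k ^ 2" using k by simp
  then have L: "0 \<le> L"
    unfolding L_def by (intro mult_nonneg_nonneg divide_nonneg_nonneg ln_ge_zero) linarith+
  have len: "length as = n" "as \<noteq> []"
    using as False by (auto simp: feasible_schedule_def n_def)
  have "feasible l (real k) V (set (take (Suc (n - 1)) \<sigma>)) (as ! (n - 1))"
    using as False unfolding feasible_schedule_def n_def by (metis diff_less length_greater_0_conv less_one)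
  then have cc: "cc_condition V (set (take n \<sigma>)) (last as)"
    using len False by (simp add: last_conv_nth feasible_def n_def)
  have cnt: "counted a\<^sub>0 (connected_components V (set (take n \<sigma>))) (fst (st n)) (snd (st n))"
    using invariant_state[of n] by (simp add: invariant_def case_prod_unfold n_def)
  have "\<delta> * (\<Sum>i<n. real (moves V (fst (st i)) (fst (st (Suc i))))) \<le> (1 + \<delta>) * real (sum (snd (st n)) V)"
    using sum_moves_state[of n] by (simp add: \<delta>_def n_def)
  also have "\<dots> \<le> (1 + \<delta>) * (L * real M)"
  proof (intro mult_left_mono)
    have "real (sum (snd (st n)) V) \<le> L * real (moves V a\<^sub>0 (last as))"
      unfolding L_def using card_component_le[of n]
      by (intro sum_counted_le_moves[OF fin k _ cnt cc]) (simp add: n_def)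
    also have "\<dots> \<le> L * real M"
      using moves_last_le_sum[OF fin len(2), of a\<^sub>0] L
      unfolding M_def by (intro mult_left_mono of_nat_mono)
    finally show "real (sum (snd (st n)) V) \<le> L * real M" .
  qed (use \<delta> in simp)
  finally have "(\<Sum>i<n. real (moves V (fst (st i)) (fst (st (Suc i))))) \<le> (1 + \<delta>) / \<delta> * L * real M"
    using \<delta> by (simp add: field_simps)
  then have "(\<Sum>i<n. real (moves V (fst (st i)) (fst (st (Suc i))))) / real k \<le>
      (1 + \<delta>) / \<delta> * L * real M / real k"
    by (rule divide_right_mono) simp
  moreover have "schedule_cost k V a\<^sub>0 as = real M / real k"
    by (simp add: schedule_cost_def M_def sum_divide_distrib)
  ultimately show ?thesis
    by (simp add: schedule_cost_run \<delta>_def L_def n_def)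
qed

text \<open>Ensures that the infimum in \<open>opt_cost\<close> ranges over a nonempty set. A
  schedule imposes no relation between consecutive assignments, so one can be picked for each
  prefix.\<close>

lemma ex_feasible_schedule: "\<exists>as. feasible_schedule l (real k) V \<sigma> as"
proof -
  have "\<forall>i. \<exists>a. i < length \<sigma> \<longrightarrow> feasible l (real k) V (set (take (Suc i) \<sigma>)) a"
    using req by (auto simp: request_sequence_def)
  then obtain f where "\<forall>i. i < length \<sigma> \<longrightarrow> feasible l (real k) V (set (take (Suc i) \<sigma>)) (f i)"
    by metis
  then have "feasible_schedule l (real k) V \<sigma> (map f [0..<length \<sigma>])"
    by (simp add: feasible_schedule_def)
  then show ?thesis by blast
qed

lemma run_cost_le_opt_cost:
  "schedule_cost k V a\<^sub>0 (run (\<lambda>a \<sigma>. fst (state \<epsilon> l k V a (rev \<sigma>))) a\<^sub>0 \<sigma>) \<le>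
   (1 + min 1 (\<epsilon> - 1)) / min 1 (\<epsilon> - 1) * (4 * (ln (2 * real k ^ 2) / ln (3/2))) *
   opt_cost l k V a\<^sub>0 \<sigma>" (is "?c \<le> ?f * _")
proof -
  have "1 \<le> real k ^ 2" using k by simp
  \<comment> \<open>The 2 inside the logarithm keeps it positive even for \<open>k = 1\<close>.
    Positivity permits dividing by the factor to obtain a lower bound on the infimum.\<close>
  then have f: "0 < ?f"
    using eps by (intro mult_pos_pos divide_pos_pos ln_gt_zero) auto
  have "?c / ?f \<le> opt_cost l k V a\<^sub>0 \<sigma>"
    unfolding opt_cost_def
  proof (rule cInf_greatest)
    show "{schedule_cost k V a\<^sub>0 as |as. feasible_schedule l (real k) V \<sigma> as} \<noteq> {}"
      using ex_feasible_schedule by auto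
  next
    fix x assume "x \<in> {schedule_cost k V a\<^sub>0 as |as. feasible_schedule l (real k) V \<sigma> as}"
    then have "?c \<le> ?f * x"
      using run_cost_le_schedule_cost by blast
    then show "?c / ?f \<le> x"
      unfolding pos_divide_le_eq[OF f] by (simp only: mult.commute)
  qed
  then show ?thesis
    unfolding pos_divide_le_eq[OF f] by (simp only: mult.commute)
qed

end

section \<open>The competitive ratio\<close>

lemma ennreal_divide_le:
  assumes "x \<le> f * y" "0 \<le> x" "0 < f"
  shows "ennreal x / ennreal y \<le> ennreal f"
proof (cases "0 < y")
  case True
  then show ?thesis
    using assms by (simp add: divide_ennreal pos_divide_le_eq)
next
  \<comment> \<open>Here \<open>ennreal y = 0\<close>, so \<open>x\<close> has to vanish as well,
    and \<open>0 / 0 = 0\<close> in \<open>ennreal\<close>.\<close>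
  case False
  then have "f * y \<le> 0" using assms(3) by (simp add: mult_le_0_iff)
  then have "x = 0" using assms by simp
  then show ?thesis by simp
qed

theorem theorem5p2:
  fixes \<epsilon> :: real
  assumes "\<epsilon> > 1"
  shows "\<exists>f :: nat \<Rightarrow> real. f \<in> O(\<lambda>k. ln (real k)) \<and>
    (\<forall>(l::nat) (k::nat) (V :: 'v set). l \<ge> 1 \<longrightarrow> k \<ge> 1 \<longrightarrow> finite V \<longrightarrow> card V = l * k \<longrightarrow>
      (\<exists>A. online_algorithm \<epsilon> l k V A \<and> competitive_ratio l k V A \<le> ennreal (f k)))"
proof -
  \<comment> \<open>\<open>K\<close> depends on \<epsilon> alone, so \<open>f\<close> is the same
    for every number of servers.\<close>
  define K where "K = (1 + min 1 (\<epsilon> - 1)) / min 1 (\<epsilon> - 1)"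
  define f where "f = (\<lambda>k::nat. K * (4 * (ln (2 * real k ^ 2) / ln (3/2))))"
  have K: "0 < K" using assms by (simp add: K_def)
  have "f \<in> O(\<lambda>k. ln (real k))"
  proof (rule bigoI)
    show "\<forall>\<^sub>F k in sequentially. norm (f k) \<le> (12 * K / ln (3/2)) * norm (ln (real k))"
      using eventually_ge_at_top[of 2]
    proof eventually_elim
      case (elim k)
      \<comment> \<open>For \<open>k\<close> at least 2, \<open>2 * k^2\<close> is at most
        \<open>k^3\<close>; this 3 and the 4 in \<open>f\<close> give the constant 12.\<close>
      have "ln (2 * real k ^ 2) \<le> ln (real k ^ 3)"
        using elim by (intro ln_mono) (auto simp: power2_eq_square power3_eq_cube)
      also have "\<dots> = 3 * ln (real k)"
        using elim by (simp add: ln_realpow)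
      finally have le: "ln (2 * real k ^ 2) \<le> 3 * ln (real k)" .
      have "1 \<le> real k ^ 2" using elim by simp
      then have "0 \<le> ln (2 * real k ^ 2)" by (intro ln_ge_zero) linarith
      moreover have "0 \<le> ln (real k)" using elim by simp
      ultimately have "norm (f k) = 4 * K / ln (3/2) * ln (2 * real k ^ 2)"
        using K by (simp add: f_def)
      also have "\<dots> \<le> 4 * K / ln (3/2) * (3 * ln (real k))"
        using K le by (intro mult_left_mono) auto
      finally show ?case
        using \<open>0 \<le> ln (real k)\<close> by simp
    qed
  qed
  moreover have "\<exists>A. online_algorithm \<epsilon> l k V A \<and> competitive_ratio l k V A \<le> ennreal (f k)"
    if "1 \<le> l" "1 \<le> k" "finite V" "card V = l * k" for l k and V :: "'v set"
  proof (intro exI conjI)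
    let ?A = "\<lambda>a \<sigma>. fst (state \<epsilon> l k V a (rev \<sigma>))"
    note ctxt = that(3,4,1,2) assms
    show "online_algorithm \<epsilon> l k V ?A"
      unfolding online_algorithm_def using feasible_schedule_run[OF ctxt] by blast
    have "1 \<le> real k ^ 2" using that by simp
    then have "0 < f k"
      unfolding f_def using K by (intro mult_pos_pos divide_pos_pos ln_gt_zero) auto
    moreover have "schedule_cost k V a (run ?A a \<sigma>) \<le> f k * opt_cost l k V a \<sigma>"
      if "initial_assignment l k V a" "request_sequence l k V \<sigma>" for a \<sigma>
      unfolding f_def K_def by (rule run_cost_le_opt_cost[OF ctxt that])
    moreover have "0 \<le> schedule_cost k V a (run ?A a \<sigma>)" for a \<sigma>
      by (simp add: schedule_cost_def sum_nonneg)
    ultimately show "competitive_ratio l k V ?A \<le> ennreal (f k)"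
      unfolding competitive_ratio_def by (intro SUP_least) (auto intro!: ennreal_divide_le)
  qed
  ultimately show ?thesis by blast
qed

end
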